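(* Let $(E,\|\cdot\|)$ be a real Banach space, with $E$ regarded as a subspace of its bidual $E^{**}$ via the canonical embedding. Let $r\in(0,\infty)$ and let $X$ be a Radon $E$-valued random variable with $\mathbb E\|X\|^r<\infty$. (a) For every $n\in\mathbb N$, $$e_{n,r}(X,E)=e_{n,r}(X,E^{**}).$$ In particular, $$\mathcal C_{n,r}(X,E)=\{\alpha\in\mathcal C_{n,r}(X,E^{**}):\alpha\subset E\}.$$ If $\mathrm{card}(\mathrm{supp}(\mathbb P_X))\ge n$, then $e_{1,r}(X,E)>\cdots>e_{n,r}(X,E)$. (b) Assume that $E$ is admissible and that $\mathrm{supp}(\mathbb P_X)=E$. Then, for every $n\in\mathbb N$, $$\mathcal C_{n,r}(X,E)=\mathcal C_{n,r}(X,E^{**}).$$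
   Context: $\mathbb P_X$ denotes the distribution of $X$ and $\mathrm{supp}(\mathbb P_X)$ its topological support in $E$. An $E$-valued random variable $X$ is Radon if it is Borel measurable and $\mathbb P_X$ is a Radon probability measure on $E$ (equivalently tight); $X$ is then also Radon as a random variable with values in any Banach space $G$ containing $E$ as a Banach subspace. For a Banach space $G\supset E$ (including $G=E$) and $n\in\mathbb N$ let $$e_{n,r}(X,G):=\inf\Big\{\big(\mathbb E\min_{a\in\alpha}\|X-a\|^r\big)^{1/r}:\alpha\subset G,\ 1\le\mathrm{card}(\alpha)\le n\Big\},$$ and let $\mathcal C_{n,r}(X,G)$ be the set of all $\alpha\subset G$ with $1\le\mathrm{card}(\alpha)\le n$ and $(\mathbb E\min_{a\in\alpha}\|X-a\|^r)^{1/r}=e_{n,r}(X,G)$. $E$ is admissible if the system of closed balls $\{B_E(x,\rho):x\in E,\rho>0\}$, $B_E(x,\rho)=\{y\in E:\|y-x\|\le\rho\}$, is compact in the following sense: each of its subsystems all of whose finite subsystems have nonempty intersection has itself nonempty intersection. *)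

theory Defs
  imports "HOL-Probability.Probability"
begin

definition canonical_embedding ::
    "'a::real_normed_vector \<Rightarrow> ('a \<Rightarrow>\<^sub>L real) \<Rightarrow>\<^sub>L real" where
  "canonical_embedding x = Blinfun (\<lambda>f. blinfun_apply f x)"

lemma blinfun_apply_canonical_embedding [simp]:
  "blinfun_apply (canonical_embedding x) f = blinfun_apply f x"
  by (simp add: canonical_embedding_def bounded_linear_Blinfun_apply)

definition radon_prob :: "'a::topological_space measure \<Rightarrow> bool" where
  "radon_prob P \<longleftrightarrow> prob_space P \<and> sets P = sets borel \<and>
     (\<forall>B\<in>sets P. \<forall>\<epsilon>>0. \<exists>K\<subseteq>B. compact K \<and> measure P (B - K) < \<epsilon>)"

definition radon_rv :: "'w measure \<Rightarrow> ('w \<Rightarrow> 'a::topological_space) \<Rightarrow> bool" where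
  "radon_rv M X \<longleftrightarrow> X \<in> measurable M borel \<and> radon_prob (distr M borel X)"

definition measure_supp :: "'a::topological_space measure \<Rightarrow> 'a set" where
  "measure_supp P = {x. \<forall>U. open U \<and> x \<in> U \<longrightarrow> 0 < measure P U}"

text \<open>
  In the following definitions the ambient space \<open>G\<close> is the whole codomain type of the
  random variable. For an \<open>E\<close>-valued \<open>X\<close> and an embedding \<open>j\<close> of \<open>E\<close> into \<open>G\<close>, the quantities
  for \<open>X\<close> with codebooks in \<open>G\<close> are those of \<open>j \<circ> X\<close>.
\<close>

definition quant_cost :: "'w measure \<Rightarrow> real \<Rightarrow> ('w \<Rightarrow> 'g::real_normed_vector) \<Rightarrow> 'g set \<Rightarrow> real" where
  "quant_cost M r X \<alpha> = (\<integral>\<omega>. (MIN a\<in>\<alpha>. norm (X \<omega> - a) powr r) \<partial>M) powr (1 / r)"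

text \<open>The bound \<open>1 \<le> card \<alpha>\<close> entails that \<open>\<alpha>\<close> is finite, as infinite sets have cardinality 0.\<close>

definition codebooks :: "nat \<Rightarrow> 'g set set" where
  "codebooks n = {\<alpha>. 1 \<le> card \<alpha> \<and> card \<alpha> \<le> n}"

definition quant_error :: "'w measure \<Rightarrow> nat \<Rightarrow> real \<Rightarrow> ('w \<Rightarrow> 'g::real_normed_vector) \<Rightarrow> real" where
  "quant_error M n r X = (INF \<alpha>\<in>codebooks n. quant_cost M r X \<alpha>)"

definition optimal_codebooks ::
    "'w measure \<Rightarrow> nat \<Rightarrow> real \<Rightarrow> ('w \<Rightarrow> 'g::real_normed_vector) \<Rightarrow> 'g set set" where
  "optimal_codebooks M n r X =
     {\<alpha> \<in> codebooks n. quant_cost M r X \<alpha> = quant_error M n r X}"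

definition admissible_space :: "'a::metric_space itself \<Rightarrow> bool" where
  "admissible_space _ \<longleftrightarrow>
     (\<forall>\<B> \<subseteq> {cball (x::'a) \<rho> | x \<rho>. \<rho> > 0}.
        (\<forall>\<F>\<subseteq>\<B>. finite \<F> \<longrightarrow> \<Inter>\<F> \<noteq> {}) \<longrightarrow> \<Inter>\<B> \<noteq> {})"

end

theory Submission
  imports Defs
begin

text \<open>
  Write \<open>j\<close> for the canonical embedding of \<open>E\<close> into its bidual, which is an isometry by
  Hahn-Banach, so that enlarging the space of codebooks can only decrease the error.

  The two errors agree because a single point \<open>a\<close> of the bidual can be imitated by points of \<open>E\<close>:
  for finitely many \<open>x\<^sub>1, \<dots>, x\<^sub>m\<close> and \<open>\<delta> > 0\<close> there is \<open>b \<in> E\<close> with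
  \<open>\<parallel>x\<^sub>i - b\<parallel> \<le> \<parallel>j x\<^sub>i - a\<parallel> + \<delta>\<close> for all \<open>i\<close> (lemma \<open>bidual_point_approximation\<close>). If there were
  none, a functional on the power \<open>E\<^sup>m\<close> would separate the product of the balls from the diagonal. Its
  components \<open>f\<^sub>i\<close> would then satisfy \<open>\<Sum>f\<^sub>i = 0\<close>, hence \<open>\<Sum>f\<^sub>i x\<^sub>i = \<Sum>(j x\<^sub>i - a) f\<^sub>i\<close>, which is too
  small for a separating functional. This much of the principle of local reflexivity suffices,
  since the points of a codebook may be replaced one by one. A Radon variable takes almost all its values in
  the closure of a sequence; approximating along longer and longer initial segments of that sequence
  gives codebooks in \<open>E\<close> whose distortion is asymptotically at most that of the given codebook at
  almost every value, and dominated convergence transfers this to the errors.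

  The strict decrease comes from a gain that is uniform over all codebooks. Given \<open>k + 1\<close> separated points of the support and
  \<open>k\<close> code points, some support point is far from all of them by the pigeonhole principle. Adding it
  lowers the mean distortion by an amount that does not depend on the codebook, so the infimum drops
  as well.

  If \<open>E\<close> is admissible, the point \<open>b\<close> can be chosen with \<open>\<parallel>x - b\<parallel> \<le> \<parallel>j x - a\<parallel>\<close> for all \<open>x\<close>
  at once. Replacing each point of an optimal codebook \<open>\<alpha>\<close> of the bidual in this way gives an optimal
  codebook \<open>\<beta>\<close> of \<open>E\<close> whose distortion is pointwise at most that of \<open>\<alpha>\<close>. The means agree and both
  functions are continuous, so they agree on the support, which is all of \<open>E\<close>. Evaluating at the
  points of \<open>\<beta>\<close>, where the distortion vanishes, yields \<open>j ` \<beta> \<subseteq> \<alpha>\<close>. A point of \<open>\<alpha>\<close> outside of \<open>E\<close>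
  would make the inclusion proper, so that fewer points would achieve the same error, against the
  strict decrease.
\<close>

section \<open>Dominated functionals\<close>

definition sublinear :: "('v::real_vector \<Rightarrow> real) \<Rightarrow> bool" where
  "sublinear p \<longleftrightarrow> (\<forall>x y. p (x + y) \<le> p x + p y) \<and> (\<forall>c\<ge>0. \<forall>x. p (c *\<^sub>R x) = c * p x)"

lemma sublinearI:
  assumes add: "\<And>x y. p (x + y) \<le> p x + p y"
    and zero: "p 0 = 0"
    and scale: "\<And>c x. 0 < c \<Longrightarrow> p (c *\<^sub>R x) \<le> c * p x"
  shows "sublinear p"
  unfolding sublinear_def
proof (intro conjI allI impI)
  fix c :: real and x
  assume "0 \<le> c"
  show "p (c *\<^sub>R x) = c * p x"
  proof (cases "c = 0")
    case True
    then show ?thesis using zero by simp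
  next
    case False
    with \<open>0 \<le> c\<close> have c: "0 < c" by simp
    have "p x \<le> inverse c * p (c *\<^sub>R x)"
      using scale[of "inverse c" "c *\<^sub>R x"] c by simp
    then have "c * p x \<le> p (c *\<^sub>R x)"
      using c by (simp add: field_simps)
    with scale[OF c, of x] show ?thesis by simp
  qed
qed (rule add)

lemma sublinear_add: "sublinear p \<Longrightarrow> p (x + y) \<le> p x + p y"
  and sublinear_scale: "sublinear p \<Longrightarrow> 0 \<le> c \<Longrightarrow> p (c *\<^sub>R x) = c * p x"
  by (auto simp: sublinear_def)

lemma sublinear_zero: "sublinear p \<Longrightarrow> p 0 = 0"
  using sublinear_scale[of p 0 0] by simp

lemma sublinear_ge_minus: "sublinear p \<Longrightarrow> - p (- x) \<le> p x"
  using sublinear_add[of p x "- x"] sublinear_zero[of p] by simp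

text \<open>
  The largest sublinear function below \<open>p\<close> whose value at \<open>- y\<close> is at most \<open>- p y\<close>, so that it is
  linear on the line spanned by \<open>y\<close>. It serves twice: it shows that minimal sublinear functions are additive, and it
  prescribes the value of the functional at a given point.
\<close>

definition slide :: "('v::real_vector \<Rightarrow> real) \<Rightarrow> 'v \<Rightarrow> 'v \<Rightarrow> real" where
  "slide p y x = (INF t\<in>{0..}. p (x + t *\<^sub>R y) - t * p y)"

lemma slide_bound:
  assumes "sublinear p" "0 \<le> t"
  shows "- p (- x) \<le> p (x + t *\<^sub>R y) - t * p y"
  using sublinear_add[OF assms(1), of "- x" "x + t *\<^sub>R y"] sublinear_scale[OF assms, of y] by simp

lemma slide_le:
  assumes "sublinear p" "0 \<le> t"
  shows "slide p y x \<le> p (x + t *\<^sub>R y) - t * p y"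
  unfolding slide_def
  using assms slide_bound[OF assms(1)]
  by (intro cINF_lower bdd_belowI2[where m = "- p (- x)"]) auto

lemma slide_greatest:
  assumes "\<And>t. 0 \<le> t \<Longrightarrow> z \<le> p (x + t *\<^sub>R y) - t * p y"
  shows "z \<le> slide p y x"
  unfolding slide_def using assms by (intro cINF_greatest) auto

lemma slide_sublinear:
  assumes p: "sublinear p"
  shows "sublinear (slide p y)"
proof (rule sublinearI)
  fix u v
  have "slide p y (u + v) - (p (v + t *\<^sub>R y) - t * p y) \<le> slide p y u" if t: "0 \<le> t" for t
  proof (rule slide_greatest)
    fix s :: real
    assume s: "0 \<le> s"
    have "slide p y (u + v) \<le> p (u + v + (s + t) *\<^sub>R y) - (s + t) * p y"
      using slide_le[OF p, of "s + t"] s t by simp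
    also have "u + v + (s + t) *\<^sub>R y = (u + s *\<^sub>R y) + (v + t *\<^sub>R y)"
      by (simp add: algebra_simps)
    finally show "slide p y (u + v) - (p (v + t *\<^sub>R y) - t * p y) \<le> p (u + s *\<^sub>R y) - s * p y"
      using sublinear_add[OF p, of "u + s *\<^sub>R y" "v + t *\<^sub>R y"] by (simp add: algebra_simps)
  qed
  then have "slide p y (u + v) - slide p y u \<le> slide p y v"
    by (intro slide_greatest) (simp add: algebra_simps)
  then show "slide p y (u + v) \<le> slide p y u + slide p y v" by simp
next
  have "slide p y 0 \<le> 0"
    using slide_le[OF p order_refl, of y 0] sublinear_zero[OF p] by simp
  moreover have "0 \<le> slide p y 0"
    by (rule slide_greatest) (simp add: sublinear_scale[OF p])
  ultimately show "slide p y 0 = 0" by simp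
next
  fix c :: real and x
  assume c: "0 < c"
  have "slide p y (c *\<^sub>R x) / c \<le> slide p y x"
  proof (rule slide_greatest)
    fix t :: real
    assume t: "0 \<le> t"
    have "slide p y (c *\<^sub>R x) \<le> p (c *\<^sub>R x + (c * t) *\<^sub>R y) - (c * t) * p y"
      using slide_le[OF p, of "c * t"] c t by simp
    also have "p (c *\<^sub>R x + (c * t) *\<^sub>R y) = c * p (x + t *\<^sub>R y)"
      using sublinear_scale[OF p, of c "x + t *\<^sub>R y"] c by (simp add: scaleR_add_right)
    finally show "slide p y (c *\<^sub>R x) / c \<le> p (x + t *\<^sub>R y) - t * p y"
      using c by (simp add: field_simps)
  qed
  then show "slide p y (c *\<^sub>R x) \<le> c * slide p y x"
    using c by (simp add: field_simps)
qed

text \<open>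
  Zorn's lemma on the pointwise order. All functions in question are bounded below at \<open>x\<close> by
  \<open>- p (- x)\<close>, so the pointwise infimum of a chain is finite; it is subadditive because any two members
  of a chain lie above a common one.
\<close>

lemma minimal_sublinear_exists:
  assumes p: "sublinear p"
  obtains q where "sublinear q" "q \<le> p" "\<And>q'. sublinear q' \<Longrightarrow> q' \<le> q \<Longrightarrow> q' = q"
proof -
  define A where "A = {q. sublinear q \<and> q \<le> p}"
  have po: "partial_order_on A (relation_of (\<lambda>a b. b \<le> a) A)"
    by (auto simp: partial_order_on_def preorder_on_def refl_on_def trans_def antisym_def relation_of_def)
  have "\<exists>m\<in>A. \<forall>a\<in>A. a \<le> m \<longrightarrow> a = m"
  proof (rule predicate_Zorn[OF po])
    fix C
    assume C: "C \<in> Chains (relation_of (\<lambda>a b. b \<le> a) A)"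
    then have CA: "C \<subseteq> A" and chain: "\<And>a b. a \<in> C \<Longrightarrow> b \<in> C \<Longrightarrow> a \<le> b \<or> b \<le> a"
      by (auto simp: Chains_def relation_of_def)
    show "\<exists>u\<in>A. \<forall>a\<in>C. u \<le> a"
    proof (cases "C = {}")
      case True
      then show ?thesis using p by (auto simp: A_def)
    next
      case False
      define u where "u x = (INF q\<in>C. q x)" for x
      have lower: "- p (- x) \<le> q x" if "q \<in> C" for q x
        using sublinear_ge_minus[of q x] le_funD[of q p "- x"] CA that by (force simp: A_def)
      have u_le: "u x \<le> q x" if "q \<in> C" for q x
        unfolding u_def using lower that
        by (intro cINF_lower bdd_belowI2[where m = "- p (- x)"]) auto
      have u_ge: "z \<le> u x" if "\<And>q. q \<in> C \<Longrightarrow> z \<le> q x" for z x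
        unfolding u_def using False that by (intro cINF_greatest) auto
      have sub: "sublinear q" if "q \<in> C" for q
        using that CA by (auto simp: A_def)
      have "sublinear u"
      proof (rule sublinearI)
        fix x y
        have "u (x + y) - q2 y \<le> u x" if q2: "q2 \<in> C" for q2
        proof (rule u_ge)
          fix q1
          assume q1: "q1 \<in> C"
          have "\<exists>q\<in>C. q \<le> q1 \<and> q \<le> q2"
            using chain[OF q1 q2] q1 q2 by auto
          then obtain q where q: "q \<in> C" "q \<le> q1" "q \<le> q2" by blast
          have "u (x + y) \<le> q x + q y"
            using u_le[OF q(1), of "x + y"] sublinear_add[OF sub[OF q(1)], of x y] by simp
          then show "u (x + y) - q2 y \<le> q1 x"
            using le_funD[OF q(2), of x] le_funD[OF q(3), of y] by simp
        qed
        then have "u (x + y) - u x \<le> u y"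
          by (intro u_ge) (simp add: algebra_simps)
        then show "u (x + y) \<le> u x + u y" by simp
      next
        have "(\<lambda>q. q 0) ` C = {0}" using sub sublinear_zero False by fastforce
        then show "u 0 = 0" unfolding u_def by simp
      next
        fix c :: real and x
        assume c: "0 < c"
        have "u (c *\<^sub>R x) / c \<le> u x"
        proof (rule u_ge)
          fix q
          assume "q \<in> C"
          then show "u (c *\<^sub>R x) / c \<le> q x"
            using u_le[of q "c *\<^sub>R x"] sublinear_scale[OF sub, of q c x] c by (simp add: field_simps)
        qed
        then show "u (c *\<^sub>R x) \<le> c * u x" using c by (simp add: field_simps)
      qed
      moreover have "u \<le> q" if "q \<in> C" for q
        using u_le[OF that] by (auto simp: le_fun_def)
      moreover have "u \<le> p"
        using False CA calculation(2) by (force simp: A_def intro: order_trans)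
      ultimately show ?thesis by (auto simp: A_def)
    qed
  qed
  then obtain q where q: "q \<in> A" "\<And>a. a \<in> A \<Longrightarrow> a \<le> q \<Longrightarrow> a = q" by blast
  show ?thesis
  proof (rule that)
    show "sublinear q" "q \<le> p" using q(1) by (auto simp: A_def)
    fix q'
    assume q': "sublinear q'" "q' \<le> q"
    with \<open>q \<le> p\<close> have "q' \<in> A" by (auto simp: A_def intro: order_trans)
    with q(2) q'(2) show "q' = q" by blast
  qed
qed

text \<open>
  A minimal sublinear function \<open>q\<close> equals \<open>slide q y\<close> for every \<open>y\<close>, and the parameter \<open>1\<close> in the
  definition of \<open>slide\<close> turns this into \<open>q x + q y \<le> q (x + y)\<close>, so \<open>q\<close> is linear. Starting from
  \<open>slide p x0\<close> instead of \<open>p\<close> forces \<open>q (- x0) \<le> - p x0\<close>.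
\<close>

lemma Hahn_Banach_dominated:
  fixes p :: "'v::real_vector \<Rightarrow> real"
  assumes p: "sublinear p"
  obtains f where "linear f" "\<And>x. f x \<le> p x" "f x0 = p x0"
proof -
  obtain q where q: "sublinear q" "q \<le> slide p x0"
    and min: "\<And>q'. sublinear q' \<Longrightarrow> q' \<le> q \<Longrightarrow> q' = q"
    using minimal_sublinear_exists[OF slide_sublinear[OF p]] by metis
  have slide_below: "slide g y x \<le> g x" if "sublinear g" for g :: "'v \<Rightarrow> real" and x y
    using slide_le[OF that order_refl, of y x] by simp
  have add: "q (x + y) = q x + q y" for x y
  proof -
    have "slide q y = q"
      using slide_below[OF q(1)] by (intro min slide_sublinear q(1)) (auto simp: le_fun_def)
    then have "q x \<le> q (x + y) - q y"
      using slide_le[OF q(1), of 1 y x] by simp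
    with sublinear_add[OF q(1), of x y] show ?thesis by simp
  qed
  have minus: "q (- x) = - q x" for x
    using add[of x "- x"] sublinear_zero[OF q(1)] by simp
  have scale: "q (c *\<^sub>R x) = c * q x" for c x
  proof (cases "0 \<le> c")
    case True
    then show ?thesis by (rule sublinear_scale[OF q(1)])
  next
    case False
    then have "q ((- c) *\<^sub>R x) = - c * q x" by (intro sublinear_scale q(1)) auto
    then show ?thesis using minus[of "c *\<^sub>R x"] by simp
  qed
  have le: "q x \<le> p x" for x
    using le_funD[OF q(2), of x] slide_below[OF p, of x0 x] by simp
  have "q (- x0) \<le> - p x0"
    using le_funD[OF q(2), of "- x0"] slide_le[OF p, of 1 x0 "- x0"] sublinear_zero[OF p] by simp
  with le[of x0] have "q x0 = p x0" by (simp add: minus)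
  moreover have "linear q" by (rule linearI) (auto simp: add scale)
  ultimately show ?thesis using le that by blast
qed

section \<open>The embedding into the bidual\<close>

lemma canonical_embedding_diff:
  "canonical_embedding (x - y) = canonical_embedding x - canonical_embedding y"
  by (rule blinfun_eqI) (simp add: blinfun.diff_left blinfun.diff_right)

lemma norm_canonical_embedding [simp]:
  fixes x :: "'a::real_normed_vector"
  shows "norm (canonical_embedding x) = norm x"
proof (rule antisym)
  show "norm (canonical_embedding x) \<le> norm x"
  proof (rule norm_blinfun_bound)
    show "norm (blinfun_apply (canonical_embedding x) f) \<le> norm x * norm f" for f
      using norm_blinfun[of f x] by (simp add: mult.commute)
  qed simp
next
  have "sublinear (norm :: 'a \<Rightarrow> real)"
    by (auto simp: sublinear_def norm_triangle_ineq)
  then obtain f where f: "linear f" "\<And>y. f y \<le> norm (y :: 'a)" "f x = norm x"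
    by (rule Hahn_Banach_dominated[of _ x]) blast
  have abs: "\<bar>f y\<bar> \<le> norm y" for y
    using f(2)[of y] f(2)[of "- y"] linear_neg[OF f(1), of y] by (simp add: abs_le_iff)
  have bl: "bounded_linear f"
    using f(1) abs by (intro bounded_linear_intro[where K = 1])
      (auto simp: linear_add linear_scale)
  have "norm (Blinfun f) \<le> 1"
    by (rule norm_blinfun_bound) (auto simp: bounded_linear_Blinfun_apply[OF bl] abs)
  have "norm x = blinfun_apply (canonical_embedding x) (Blinfun f)"
    by (simp add: bounded_linear_Blinfun_apply[OF bl] f(3))
  also have "\<dots> \<le> norm (canonical_embedding x) * norm (Blinfun f)"
    using norm_blinfun[of "canonical_embedding x" "Blinfun f"] by (simp del: blinfun_apply_canonical_embedding)
  also have "\<dots> \<le> norm (canonical_embedding x)"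
    using mult_left_mono[OF \<open>norm (Blinfun f) \<le> 1\<close>, of "norm (canonical_embedding x)"] by simp
  finally show "norm x \<le> norm (canonical_embedding x)" .
qed

lemma norm_canonical_embedding_diff [simp]:
  "norm (canonical_embedding x - canonical_embedding y) = norm (x - y)"
  by (simp flip: canonical_embedding_diff)

lemma inj_canonical_embedding: "inj canonical_embedding"
  by (rule injI) (metis norm_canonical_embedding_diff norm_eq_zero right_minus_eq)

lemma continuous_on_canonical_embedding [continuous_intros]:
  "continuous_on S canonical_embedding"
  unfolding continuous_on_iff by (auto simp: dist_norm)

section \<open>Imitating bidual points\<close>

text \<open>
  The distance to the range of \<open>D\<close> is the seminorm pulled back from the quotient by that range. A functional that it
  dominates vanishes on the range.
\<close>

lemma quotient_seminorm_sublinear: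
  fixes D :: "'a::real_vector \<Rightarrow> 'b::real_normed_vector"
  assumes D: "linear D"
  shows "sublinear (\<lambda>z. INF v. norm (z - D v))"
proof -
  define p where "p z = (INF v. norm (z - D v))" for z
  have p_le: "p z \<le> norm (z - D v)" for z v
    unfolding p_def by (intro cINF_lower bdd_belowI2[where m = 0]) auto
  have p_ge: "c \<le> p z" if "\<And>v. c \<le> norm (z - D v)" for c z
    unfolding p_def using that by (intro cINF_greatest) auto
  have "sublinear p"
  proof (rule sublinearI)
    fix x y
    have "p (x + y) - norm (y - D w) \<le> p x" for w
    proof (rule p_ge)
      fix v
      have "p (x + y) \<le> norm ((x - D v) + (y - D w))"
        using p_le[of "x + y" "v + w"] by (simp add: linear_add[OF D] algebra_simps)
      then show "p (x + y) - norm (y - D w) \<le> norm (x - D v)"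
        using norm_triangle_ineq[of "x - D v" "y - D w"] by simp
    qed
    then have "p (x + y) - p x \<le> p y"
      by (intro p_ge) (simp add: algebra_simps)
    then show "p (x + y) \<le> p x + p y" by simp
  next
    show "p 0 = 0"
      using p_le[of 0 0] p_ge[of 0 0] by (simp add: linear_0[OF D])
  next
    fix c :: real and x
    assume c: "0 < c"
    have "p (c *\<^sub>R x) / c \<le> p x"
    proof (rule p_ge)
      fix v
      have "p (c *\<^sub>R x) \<le> norm (c *\<^sub>R (x - D v))"
        using p_le[of "c *\<^sub>R x" "c *\<^sub>R v"] by (simp add: linear_scale[OF D] scaleR_diff_right)
      then show "p (c *\<^sub>R x) / c \<le> norm (x - D v)"
        using c by (simp add: divide_le_eq mult.commute)
    qed
    then show "p (c *\<^sub>R x) \<le> c * p x" using c by (simp add: field_simps)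
  qed
  then show ?thesis unfolding p_def .
qed

text \<open>
  The power \<open>E\<^sup>m\<close> with the maximum norm is realised inside the bounded sequences in \<open>E\<close>, by padding with
  zeros, as the exponent \<open>m\<close> varies. Every sequence is continuous for the discrete topology of the
  natural numbers.
\<close>

definition family :: "nat \<Rightarrow> (nat \<Rightarrow> 'a::real_normed_vector) \<Rightarrow> nat \<Rightarrow>\<^sub>C 'a" where
  "family m y = Bcontfun (\<lambda>i. if i < m then y i else 0)"

lemma apply_family [simp]: "apply_bcontfun (family m y) i = (if i < m then y i else 0)"
proof -
  have "finite (insert 0 (y ` {..<m}))" by simp
  then have "bounded (range (\<lambda>i. if i < m then y i else 0))"
    by (rule bounded_subset[OF finite_imp_bounded]) auto
  then have "(\<lambda>i. if i < m then y i else 0) \<in> bcontfun"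
    by (simp add: bcontfun_def)
  then show ?thesis by (simp add: family_def Bcontfun_inverse)
qed

lemma family_add: "family m (\<lambda>i. y i + z i) = family m y + family m z"
  and family_scaleR: "family m (\<lambda>i. c *\<^sub>R y i) = c *\<^sub>R family m y"
  and family_diff: "family m (\<lambda>i. y i - z i) = family m y - family m z"
  by (auto intro!: bcontfun_eqI)

lemma norm_family_le:
  assumes "0 \<le> c" "\<And>i. i < m \<Longrightarrow> norm (y i) \<le> c"
  shows "norm (family m y) \<le> c"
  using assms by (intro norm_bound) auto

lemma norm_le_norm_family: "i < m \<Longrightarrow> norm (y i) \<le> norm (family m y)"
  using norm_bounded[of "family m y" i] by simp

lemma family_eq_sum: "family m y = (\<Sum>i<m. family m (\<lambda>j. if j = i then y i else 0))"
proof -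
  have "family m y = (\<Sum>i\<in>A. family m (\<lambda>j. if j = i then y i else 0)) + family m (\<lambda>j. if j \<in> A then 0 else y j)"
    if "finite A" for A
    using that
  proof induction
    case empty
    then show ?case by simp
  next
    case (insert k A)
    have "family m (\<lambda>j. if j \<in> A then 0 else y j) =
        family m (\<lambda>j. if j = k then y k else 0) + family m (\<lambda>j. if j \<in> insert k A then 0 else y j)"
      using insert.hyps by (auto intro!: bcontfun_eqI)
    with insert show ?case by simp
  qed
  from this[of "{..<m}"] have "family m y = (\<Sum>i<m. family m (\<lambda>j. if j = i then y i else 0)) +
      family m (\<lambda>j. if j \<in> {..<m} then 0 else y j)" by simp
  moreover have "family m (\<lambda>j. if j \<in> {..<m} then 0 else y j) = 0"
    by (auto intro!: bcontfun_eqI)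
  ultimately show ?thesis by simp
qed

text \<open>
  The dual norm of the maximum norm is the sum of the norms of the components. The bound follows by
  evaluating the functional at a family of points of the unit ball that almost attain the norms of the
  components.
\<close>

lemma family_functional:
  fixes f :: "(nat \<Rightarrow>\<^sub>C 'a::real_normed_vector) \<Rightarrow> real"
  assumes f: "linear f" and bound: "\<And>z. f z \<le> norm z"
  obtains F :: "nat \<Rightarrow> 'a \<Rightarrow>\<^sub>L real"
  where "\<And>y. f (family m y) = (\<Sum>i<m. F i (y i))" "(\<Sum>i<m. norm (F i)) \<le> 1"
proof -
  define e where "e i u = family m (\<lambda>j. if j = i then u else (0 :: 'a))" for i u
  define F where "F i = Blinfun (\<lambda>u. f (e i u))" for i
  have e_add: "e i (u + v) = e i u + e i v" and e_scale: "e i (c *\<^sub>R u) = c *\<^sub>R e i u" for i u v c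
    unfolding e_def by (auto intro!: bcontfun_eqI)
  have abs: "\<bar>f z\<bar> \<le> norm z" for z
    using bound[of z] bound[of "- z"] linear_neg[OF f, of z] by (simp add: abs_le_iff)
  have e_norm: "norm (e i u) \<le> norm u" for i u
    unfolding e_def by (rule norm_family_le) auto
  have "bounded_linear (\<lambda>u. f (e i u))" for i
    using order_trans[OF abs e_norm]
    by (intro bounded_linear_intro[where K = 1])
      (auto simp: e_add e_scale linear_add[OF f] linear_scale[OF f])
  then have F: "F i u = f (e i u)" for i u
    by (simp add: F_def bounded_linear_Blinfun_apply)
  have sum: "f (family m y) = (\<Sum>i<m. F i (y i))" for y
    by (subst family_eq_sum) (simp add: F e_def linear_sum[OF f])
  have "(\<Sum>i<m. norm (F i)) - real m * \<epsilon> \<le> 1" if \<epsilon>: "0 < \<epsilon>" for \<epsilon>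
  proof -
    have "\<exists>u. norm u \<le> 1 \<and> norm (F i) - \<epsilon> \<le> F i u" for i
    proof (rule ccontr)
      assume "\<not> ?thesis"
      then have small: "F i u < norm (F i) - \<epsilon>" if "norm u \<le> 1" for u
        using that by force
      have "norm (F i u) \<le> max 0 (norm (F i) - \<epsilon>) * norm u" for u
      proof (cases "u = 0")
        case False
        have "\<bar>F i (u /\<^sub>R norm u)\<bar> \<le> max 0 (norm (F i) - \<epsilon>)"
          using small[of "u /\<^sub>R norm u"] small[of "- (u /\<^sub>R norm u)"]
          by (auto simp: blinfun.minus_right False)
        then show ?thesis
          using False by (simp add: blinfun.scaleR_right abs_mult field_simps)
      qed simp
      then have "norm (F i) \<le> max 0 (norm (F i) - \<epsilon>)"
        by (intro norm_blinfun_bound) auto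
      moreover have "0 < norm (F i) - \<epsilon>" using small[of 0] by simp
      ultimately show False using \<epsilon> by simp
    qed
    then obtain u where u: "\<And>i. norm (u i) \<le> 1" "\<And>i. norm (F i) - \<epsilon> \<le> F i (u i)" by metis
    have "(\<Sum>i<m. norm (F i)) - real m * \<epsilon> = (\<Sum>i<m. norm (F i) - \<epsilon>)"
      by (simp add: sum_subtractf)
    also have "\<dots> \<le> (\<Sum>i<m. F i (u i))" by (rule sum_mono) (rule u)
    also have "\<dots> \<le> norm (family m u)" using bound by (simp flip: sum)
    also have "\<dots> \<le> 1" by (rule norm_family_le) (auto intro: u)
    finally show ?thesis .
  qed
  note approx = this
  have "(\<Sum>i<m. norm (F i)) \<le> 1"
  proof (rule field_le_epsilon)
    fix d :: real
    assume "0 < d"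
    have "real m * (d / (real m + 1)) \<le> d"
      using \<open>0 < d\<close> by (simp add: field_simps)
    with approx[of "d / (real m + 1)"] \<open>0 < d\<close> show "(\<Sum>i<m. norm (F i)) \<le> 1 + d" by simp
  qed
  with sum show ?thesis by (rule that)
qed

text \<open>
  Scaling the \<open>i\<close>-th coordinate by the radius \<open>\<rho> i\<close> turns the intersection problem for the balls around
  the points \<open>x i\<close> into the question whether \<open>w\<close> has distance at most one from the range of the weighted
  diagonal \<open>D\<close>. Otherwise Hahn-Banach gives a functional of norm at most one that vanishes on
  the diagonal and is at least one at \<open>w\<close>. Vanishing on the diagonal permits subtracting \<open>a\<close> from each
  of the functionals \<open>canonical_embedding (x i)\<close>, and \<open>norm (canonical_embedding (x i) - a)\<close> is smaller
  than \<open>\<rho> i\<close> by \<open>\<delta>\<close>.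
\<close>

lemma bidual_point_approximation:
  fixes a :: "('a::real_normed_vector \<Rightarrow>\<^sub>L real) \<Rightarrow>\<^sub>L real" and x :: "nat \<Rightarrow> 'a"
  assumes \<delta>: "0 < \<delta>"
  obtains b where "\<And>i. i < m \<Longrightarrow> norm (x i - b) \<le> norm (canonical_embedding (x i) - a) + \<delta>"
proof -
  define \<rho> where "\<rho> i = norm (canonical_embedding (x i) - a) + \<delta>" for i
  have \<rho>: "\<delta> \<le> \<rho> i" "0 < \<rho> i" for i
    using \<delta> by (auto simp: \<rho>_def intro: add_nonneg_pos)
  define D where "D v = family m (\<lambda>i. v /\<^sub>R \<rho> i)" for v :: 'a
  define w where "w = family m (\<lambda>i. x i /\<^sub>R \<rho> i)"
  define p where "p z = (INF v. norm (z - D v))" for z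
  have D: "linear D"
    by (rule linearI) (simp_all add: D_def scaleR_add_right mult.commute flip: family_add family_scaleR)
  have "\<exists>v. norm (w - D v) \<le> 1"
  proof (rule ccontr)
    assume "\<not> ?thesis"
    then have "1 \<le> p w"
      unfolding p_def by (intro cINF_greatest) (auto simp: not_le intro: less_imp_le)
    have "sublinear p"
      unfolding p_def by (rule quotient_seminorm_sublinear[OF D])
    then obtain f where f: "linear f" "\<And>z. f z \<le> p z" "f w = p w"
      by (rule Hahn_Banach_dominated[of _ w]) blast
    have p_le: "p z \<le> norm (z - D v)" for z v
      unfolding p_def by (intro cINF_lower bdd_belowI2[where m = 0]) auto
    have "f z \<le> norm z" for z
      using f(2)[of z] p_le[of z 0] by (simp add: linear_0[OF D])
    with f(1) obtain F where F: "\<And>y. f (family m y) = (\<Sum>i<m. blinfun_apply (F i) (y i))"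
      and F_norm: "(\<Sum>i<m. norm (F i)) \<le> 1"
      by (rule family_functional[of _ m]) blast
    have "f (D v) \<le> 0" for v
      using f(2)[of "D v"] p_le[of "D v" v] by simp
    from this this[of "- _"] have "f (D v) = 0" for v
      by (metis antisym linear_neg[OF D] linear_neg[OF f(1)] neg_le_0_iff_le)
    then have F_diag: "(\<Sum>i<m. F i /\<^sub>R \<rho> i) = 0"
      by (intro blinfun_eqI)
        (simp add: D_def F blinfun.sum_left blinfun.scaleR_left blinfun.scaleR_right)
    \<comment> \<open>A common bound for the radii, so that all the quotients \<open>1 - \<delta> / \<rho> i\<close> stay below a constant less than one; the summand \<open>\<delta>\<close> keeps it positive when \<open>m = 0\<close>.\<close>
    define R where "R = (\<Sum>i<m. \<rho> i) + \<delta>"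
    have R: "\<rho> i \<le> R" if "i < m" for i
      using member_le_sum[of i "{..<m}" \<rho>] that \<rho>(2) \<delta> by (auto simp: R_def less_imp_le)
    have R\<delta>: "\<delta> \<le> R" using sum_nonneg[of "{..<m}" \<rho>] \<rho>(2) by (simp add: R_def less_imp_le)
    have "1 \<le> f w" using \<open>1 \<le> p w\<close> f(3) by simp
    also have "f w = (\<Sum>i<m. canonical_embedding (x i) (F i /\<^sub>R \<rho> i))"
      by (simp add: w_def F blinfun.scaleR_left blinfun.scaleR_right)
    also have "\<dots> = (\<Sum>i<m. canonical_embedding (x i) (F i /\<^sub>R \<rho> i)) - a (\<Sum>i<m. F i /\<^sub>R \<rho> i)"
      by (simp add: F_diag)
    also have "\<dots> = (\<Sum>i<m. (canonical_embedding (x i) - a) (F i /\<^sub>R \<rho> i))"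
      by (simp add: blinfun.diff_left blinfun.sum_right sum_subtractf)
    also have "\<dots> \<le> (\<Sum>i<m. (1 - \<delta> / R) * norm (F i))"
    proof (rule sum_mono)
      fix i
      assume "i \<in> {..<m}"
      then have "\<delta> / R \<le> \<delta> / \<rho> i" using R \<delta> \<rho> by (intro divide_left_mono) (auto intro: mult_pos_pos less_le_trans[OF \<delta> R\<delta>])
      have "(canonical_embedding (x i) - a) (F i /\<^sub>R \<rho> i)
          \<le> norm (canonical_embedding (x i) - a) * norm (F i /\<^sub>R \<rho> i)"
        using norm_blinfun[of "canonical_embedding (x i) - a" "F i /\<^sub>R \<rho> i"] by simp
      also have "\<dots> = (1 - \<delta> / \<rho> i) * norm (F i)"
        using \<rho>[of i] by (simp add: \<rho>_def field_simps)
      also have "\<dots> \<le> (1 - \<delta> / R) * norm (F i)"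
        using \<open>\<delta> / R \<le> \<delta> / \<rho> i\<close> by (intro mult_right_mono) auto
      finally show "(canonical_embedding (x i) - a) (F i /\<^sub>R \<rho> i) \<le> (1 - \<delta> / R) * norm (F i)" .
    qed
    also have "\<dots> = (1 - \<delta> / R) * (\<Sum>i<m. norm (F i))" by (simp add: sum_distrib_left)
    also have "\<dots> \<le> 1 - \<delta> / R"
      using mult_left_mono[OF F_norm, of "1 - \<delta> / R"] \<delta> R\<delta> by simp
    also have "\<dots> < 1" using \<delta> R\<delta> by simp
    finally show False by simp
  qed
  then obtain v where v: "norm (w - D v) \<le> 1" by blast
  show ?thesis
  proof (rule that)
    fix i
    assume "i < m"
    then have "norm (x i /\<^sub>R \<rho> i - v /\<^sub>R \<rho> i) \<le> 1"
      using norm_le_norm_family[of i m "\<lambda>i. x i /\<^sub>R \<rho> i - v /\<^sub>R \<rho> i"] v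
      by (simp add: w_def D_def family_diff)
    moreover have "x i /\<^sub>R \<rho> i - v /\<^sub>R \<rho> i = (x i - v) /\<^sub>R \<rho> i"
      by (simp add: scaleR_diff_right)
    ultimately have "norm (x i - v) \<le> \<rho> i"
      using \<rho>(2)[of i] by (simp add: divide_simps)
    then show "norm (x i - v) \<le> norm (canonical_embedding (x i) - a) + \<delta>"
      by (simp add: \<rho>_def)
  qed
qed

lemma bidual_point_approximation_finite:
  fixes a :: "('a::real_normed_vector \<Rightarrow>\<^sub>L real) \<Rightarrow>\<^sub>L real"
  assumes "0 < \<delta>" "finite S"
  obtains b where "\<And>x. x \<in> S \<Longrightarrow> norm (x - b) \<le> norm (canonical_embedding x - a) + \<delta>"
proof -
  obtain m and x :: "nat \<Rightarrow> 'a" where S: "S = x ` {i. i < m}"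
    using finite_imp_nat_seg_image_inj_on[OF assms(2)] by auto
  obtain b where "\<And>i. i < m \<Longrightarrow> norm (x i - b) \<le> norm (canonical_embedding (x i) - a) + \<delta>"
    using bidual_point_approximation[OF assms(1), of m x a] by blast
  then show ?thesis by (intro that[of b]) (auto simp: S)
qed

text \<open>
  The approximations control distances only to the points of the sequence \<open>x\<close>, but distance functions are
  1-Lipschitz, so the control extends to the closure in the limit.
\<close>

lemma bidual_approximation_limsup:
  fixes b :: "nat \<Rightarrow> 'a::real_normed_vector" and x :: "nat \<Rightarrow> 'a::real_normed_vector"
  assumes b: "\<And>k i. i \<le> k \<Longrightarrow> norm (x i - b k) \<le> norm (canonical_embedding (x i) - a) + inverse (real (Suc k))"
    and y: "y \<in> closure (range x)" and e: "0 < e"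
  shows "\<forall>\<^sub>F k in sequentially. norm (y - b k) < norm (canonical_embedding y - a) + e"
proof -
  obtain i where i: "dist (x i) y < e / 3"
    using y e by (auto simp: closure_approachable dest!: spec[of _ "e / 3"])
  obtain l where l: "inverse (real (Suc l)) < e / 3"
    using reals_Archimedean[of "e / 3"] e by auto
  show ?thesis
    using eventually_ge_at_top[of "max i l"]
  proof eventually_elim
    case (elim k)
    have "inverse (real (Suc k)) \<le> inverse (real (Suc l))" using elim by simp
    moreover have "norm (y - b k) \<le> norm (x i - b k) + dist (x i) y"
      using norm_triangle_ineq[of "y - x i" "x i - b k"] by (simp add: dist_norm norm_minus_commute)
    moreover have "norm (canonical_embedding (x i) - a) \<le> dist (x i) y + norm (canonical_embedding y - a)"
      using norm_triangle_ineq[of "canonical_embedding (x i) - canonical_embedding y" "canonical_embedding y - a"]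
      by (simp add: dist_norm)
    moreover have "norm (x i - b k) \<le> norm (canonical_embedding (x i) - a) + inverse (real (Suc k))"
      using elim by (intro b) simp
    ultimately show ?case using i l by linarith
  qed
qed

text \<open>
  The balls of radius \<open>norm (canonical_embedding x - a) + \<delta>\<close> around all \<open>x\<close>, for all \<open>\<delta> > 0\<close>, have the finite
  intersection property by \<open>bidual_point_approximation\<close>; a point common to all of them is as required. The
  slack \<open>\<delta>\<close> is both what the approximation needs and what keeps the radii positive.
\<close>

lemma admissible_bidual_domination:
  fixes a :: "('a::real_normed_vector \<Rightarrow>\<^sub>L real) \<Rightarrow>\<^sub>L real"
  assumes adm: "admissible_space TYPE('a)"
  obtains b :: 'a where "\<And>x. norm (x - b) \<le> norm (canonical_embedding x - a)"
proof -
  define c where "c x \<delta> = cball x (norm (canonical_embedding x - a) + \<delta>)" for x and \<delta> :: real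
  define B where "B = {c x \<delta> | x \<delta>. 0 < \<delta>}"
  have "B \<subseteq> {cball x \<rho> | x \<rho>. \<rho> > 0}"
    unfolding B_def c_def by (force intro: add_nonneg_pos)
  moreover have "\<Inter>F \<noteq> {}" if F: "F \<subseteq> B" "finite F" for F
  proof -
    have "\<forall>S\<in>F. \<exists>x \<delta>. S = c x \<delta> \<and> 0 < \<delta>"
      using F(1) by (auto simp: B_def)
    then obtain y d where yd: "\<And>S. S \<in> F \<Longrightarrow> S = c (y S) (d S)" "\<And>S. S \<in> F \<Longrightarrow> 0 < d S"
      by metis
    define \<delta> where "\<delta> = Min (insert 1 (d ` F))"
    have \<delta>: "0 < \<delta>" "\<And>S. S \<in> F \<Longrightarrow> \<delta> \<le> d S"
      using F(2) yd(2) by (auto simp: \<delta>_def)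
    obtain b where b: "\<And>x. x \<in> y ` F \<Longrightarrow> norm (x - b) \<le> norm (canonical_embedding x - a) + \<delta>"
      using bidual_point_approximation_finite[OF \<delta>(1), of "y ` F" a] F(2) by blast
    have "b \<in> S" if "S \<in> F" for S
    proof -
      have "b \<in> c (y S) (d S)"
        using b[of "y S"] \<delta>(2)[OF that] that by (simp add: c_def dist_norm)
      then show ?thesis using yd(1)[OF that] by simp
    qed
    then show ?thesis by blast
  qed
  ultimately have "\<Inter>B \<noteq> {}"
    using adm unfolding admissible_space_def by (metis (no_types, lifting))
  then obtain b where b: "b \<in> \<Inter>B" by blast
  have "norm (x - b) \<le> norm (canonical_embedding x - a)" for x
  proof (rule field_le_epsilon)
    fix \<delta> :: real
    assume "0 < \<delta>"
    then have "c x \<delta> \<in> B" by (auto simp: B_def)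
    with b have "b \<in> c x \<delta>" by blast
    then show "norm (x - b) \<le> norm (canonical_embedding x - a) + \<delta>"
      by (simp add: c_def dist_norm)
  qed
  then show ?thesis by (rule that)
qed

section \<open>Codebooks and distortion\<close>

lemma codebooks_finite: "\<alpha> \<in> codebooks n \<Longrightarrow> finite \<alpha>"
  and codebooks_nonempty: "\<alpha> \<in> codebooks n \<Longrightarrow> \<alpha> \<noteq> {}"
  and codebooks_card: "\<alpha> \<in> codebooks n \<Longrightarrow> card \<alpha> \<le> n"
  using card_ge_0_finite[of \<alpha>] by (auto simp: codebooks_def)

lemma codebooksI: "finite \<alpha> \<Longrightarrow> \<alpha> \<noteq> {} \<Longrightarrow> card \<alpha> \<le> n \<Longrightarrow> \<alpha> \<in> codebooks n"
  by (simp add: codebooks_def Suc_le_eq card_gt_0_iff)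

lemma codebooks_image:
  assumes "\<alpha> \<in> codebooks n"
  shows "f ` \<alpha> \<in> codebooks n"
proof (rule codebooksI)
  show "card (f ` \<alpha>) \<le> n"
    using card_image_le[OF codebooks_finite[OF assms], of f] codebooks_card[OF assms] by simp
qed (use codebooks_finite[OF assms] codebooks_nonempty[OF assms] in auto)

lemma codebooks_insert:
  assumes "\<alpha> \<in> codebooks n"
  shows "insert b \<alpha> \<in> codebooks (Suc n)"
proof (rule codebooksI)
  show "card (insert b \<alpha>) \<le> Suc n"
    using card_insert_le_m1[of "Suc n" \<alpha> b] codebooks_card[OF assms] by simp
qed (use codebooks_finite[OF assms] in auto)

lemma codebooks_exist: "1 \<le> n \<Longrightarrow> codebooks n \<noteq> {}"
  using codebooksI[of "{undefined}" n] by force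

lemma codebooks_inj_image: "inj f \<Longrightarrow> f ` \<alpha> \<in> codebooks n \<longleftrightarrow> \<alpha> \<in> codebooks n"
  by (simp add: codebooks_def card_image inj_on_subset)

definition distortion :: "real \<Rightarrow> 'g::real_normed_vector set \<Rightarrow> 'g \<Rightarrow> real" where
  "distortion r \<alpha> x = (MIN a\<in>\<alpha>. norm (x - a) powr r)"

lemma distortion_le: "finite \<alpha> \<Longrightarrow> a \<in> \<alpha> \<Longrightarrow> distortion r \<alpha> x \<le> norm (x - a) powr r"
  unfolding distortion_def by (intro Min_le) auto

lemma distortion_attained:
  assumes "finite \<alpha>" "\<alpha> \<noteq> {}"
  obtains a where "a \<in> \<alpha>" "distortion r \<alpha> x = norm (x - a) powr r"
proof -
  have "distortion r \<alpha> x \<in> (\<lambda>a. norm (x - a) powr r) ` \<alpha>"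
    unfolding distortion_def using assms by (intro Min_in) auto
  then show ?thesis using that by blast
qed

lemma distortion_nonneg:
  assumes "finite \<alpha>" "\<alpha> \<noteq> {}"
  shows "0 \<le> distortion r \<alpha> x"
proof -
  obtain a where "distortion r \<alpha> x = norm (x - a) powr r"
    using distortion_attained[OF assms] by blast
  then show ?thesis by simp
qed

lemma distortion_antimono:
  assumes "finite \<beta>" "\<alpha> \<noteq> {}" "\<alpha> \<subseteq> \<beta>"
  shows "distortion r \<beta> x \<le> distortion r \<alpha> x"
  unfolding distortion_def using assms by (intro Min_antimono) auto

lemma continuous_on_distortion:
  assumes r: "0 < r" and \<alpha>: "finite \<alpha>" "\<alpha> \<noteq> {}"
  shows "continuous_on UNIV (distortion r \<alpha>)"
proof -
  have cont: "continuous_on UNIV (\<lambda>x. norm (x - a) powr r)" for a :: 'a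
    by (rule continuous_on_powr') (auto intro!: continuous_intros simp: r)
  show ?thesis
    using \<alpha>
  proof (induction rule: finite_ne_induct)
    case (singleton a)
    then show ?case using cont[of a] by (simp add: distortion_def[abs_def])
  next
    case (insert a \<alpha>)
    have "distortion r (insert a \<alpha>) = (\<lambda>x. min (norm (x - a) powr r) (distortion r \<alpha> x))"
      using insert.hyps by (intro ext) (simp add: distortion_def)
    then show ?case using continuous_on_min[OF cont[of a] insert.IH] by simp
  qed
qed

lemma distortion_isometry:
  assumes "\<And>x y. norm (j x - j y) = norm (x - y)"
  shows "distortion r (j ` \<alpha>) (j x) = distortion r \<alpha> x"
  by (simp add: distortion_def image_image assms)

locale quantized_rv = prob_space M for M :: "'w measure" +
  fixes r :: real and X :: "'w \<Rightarrow> 'g::real_normed_vector"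
  assumes r: "0 < r"
    and X [measurable]: "X \<in> borel_measurable M"
    and moment: "integrable M (\<lambda>\<omega>. norm (X \<omega>) powr r)"
begin

lemma integrable_norm_plus:
  assumes R: "0 \<le> R"
  shows "integrable M (\<lambda>\<omega>. (norm (X \<omega>) + R) powr r)"
proof (rule Bochner_Integration.integrable_bound)
  show "integrable M (\<lambda>\<omega>. 2 powr r * (norm (X \<omega>) powr r + R powr r))"
    using moment by auto
  show "(\<lambda>\<omega>. (norm (X \<omega>) + R) powr r) \<in> borel_measurable M"
    by measurable
  have "(u + R) powr r \<le> 2 powr r * (u powr r + R powr r)" if "0 \<le> u" for u
  proof -
    have "(u + R) powr r \<le> (2 * max u R) powr r"
      using that R r by (intro powr_mono2) auto
    also have "\<dots> \<le> 2 powr r * (u powr r + R powr r)"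
      using that R by (auto simp: powr_mult max_def)
    finally show ?thesis .
  qed
  then show "AE \<omega> in M. norm ((norm (X \<omega>) + R) powr r)
      \<le> norm (2 powr r * (norm (X \<omega>) powr r + R powr r))"
    by (auto intro!: AE_I2)
qed

lemma distortion_measurable:
  assumes "finite \<alpha>" "\<alpha> \<noteq> {}"
  shows "(\<lambda>\<omega>. distortion r \<alpha> (X \<omega>)) \<in> borel_measurable M"
  using measurable_compose[OF X borel_measurable_continuous_onI[OF continuous_on_distortion[OF r assms]]] .

lemma distortion_integrable:
  assumes "finite \<alpha>" "\<alpha> \<noteq> {}"
  shows "integrable M (\<lambda>\<omega>. distortion r \<alpha> (X \<omega>))"
proof -
  obtain a where a: "a \<in> \<alpha>" using assms by blast
  have "distortion r \<alpha> x \<le> (norm x + norm a) powr r" for x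
    using distortion_le[OF assms(1) a, of r x] powr_mono2[of r "norm (x - a)" "norm x + norm a"] r
      norm_triangle_ineq4[of x a] by simp
  then show ?thesis
    using integrable_norm_plus[of "norm a"] distortion_measurable[OF assms] distortion_nonneg[OF assms]
    by (intro Bochner_Integration.integrable_bound[OF integrable_norm_plus[of "norm a"]]) auto
qed

lemma quant_cost_eq: "quant_cost M r X \<alpha> = (\<integral>\<omega>. distortion r \<alpha> (X \<omega>) \<partial>M) powr (1 / r)"
  by (simp add: quant_cost_def distortion_def)

lemma mean_distortion_nonneg:
  "finite \<alpha> \<Longrightarrow> \<alpha> \<noteq> {} \<Longrightarrow> 0 \<le> (\<integral>\<omega>. distortion r \<alpha> (X \<omega>) \<partial>M)"
  by (intro integral_nonneg_AE AE_I2 distortion_nonneg)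

lemma quant_error_le:
  assumes "\<alpha> \<in> codebooks n"
  shows "quant_error M n r X \<le> quant_cost M r X \<alpha>"
  unfolding quant_error_def using assms
  by (intro cINF_lower bdd_belowI2[where m = 0]) (auto simp: quant_cost_def)

lemma quant_error_greatest:
  assumes "1 \<le> n" "\<And>\<alpha>. \<alpha> \<in> codebooks n \<Longrightarrow> z \<le> quant_cost M r X \<alpha>"
  shows "z \<le> quant_error M n r X"
  unfolding quant_error_def using assms codebooks_exist by (intro cINF_greatest) auto

lemma quant_error_nonneg: "1 \<le> n \<Longrightarrow> 0 \<le> quant_error M n r X"
  by (rule quant_error_greatest) (simp_all add: quant_cost_def)

lemma quant_error_antimono: "1 \<le> m \<Longrightarrow> m \<le> n \<Longrightarrow> quant_error M n r X \<le> quant_error M m r X"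
  by (intro quant_error_greatest quant_error_le) (auto simp: codebooks_def)

section \<open>Strict decrease of the quantization error\<close>

text \<open>
  Near \<open>b\<close> the distance to the old code points is at least \<open>3 / 2 * \<delta>\<close>, and the distance to the new one is
  at most \<open>\<delta> / 2\<close>. The gain depends on \<open>\<alpha>\<close> only through the separation \<open>2 * \<delta>\<close>, which makes it
  uniform over codebooks.
\<close>

lemma mean_distortion_gain:
  assumes \<alpha>: "finite \<alpha>" "\<alpha> \<noteq> {}" and \<delta>: "0 < \<delta>"
    and far: "\<And>a. a \<in> \<alpha> \<Longrightarrow> 2 * \<delta> \<le> dist a b"
  shows "(\<integral>\<omega>. distortion r (insert b \<alpha>) (X \<omega>) \<partial>M)
      \<le> (\<integral>\<omega>. distortion r \<alpha> (X \<omega>) \<partial>M)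
        - ((3 / 2 * \<delta>) powr r - (\<delta> / 2) powr r) * measure (distr M borel X) (ball b (\<delta> / 2))"
proof -
  define g where "g = (3 / 2 * \<delta>) powr r - (\<delta> / 2) powr r"
  define B where "B = X -` ball b (\<delta> / 2) \<inter> space M"
  have B: "B \<in> sets M" unfolding B_def by measurable
  have mB: "measure (distr M borel X) (ball b (\<delta> / 2)) = measure M B"
    unfolding B_def by (intro measure_distr) auto
  have point: "distortion r (insert b \<alpha>) (X \<omega>) + g * indicator B \<omega> \<le> distortion r \<alpha> (X \<omega>)"
    if "\<omega> \<in> space M" for \<omega>
  proof (cases "\<omega> \<in> B")
    case True
    then have near: "dist b (X \<omega>) < \<delta> / 2" by (simp add: B_def)
    have "distortion r (insert b \<alpha>) (X \<omega>) \<le> norm (X \<omega> - b) powr r"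
      using \<alpha> by (intro distortion_le) auto
    also have "\<dots> \<le> (\<delta> / 2) powr r"
      using near r by (intro powr_mono2) (auto simp: dist_norm norm_minus_commute)
    finally have upper: "distortion r (insert b \<alpha>) (X \<omega>) \<le> (\<delta> / 2) powr r" .
    obtain a where a: "a \<in> \<alpha>" "distortion r \<alpha> (X \<omega>) = norm (X \<omega> - a) powr r"
      using distortion_attained[OF \<alpha>] by blast
    have "3 / 2 * \<delta> \<le> norm (X \<omega> - a)"
      using far[OF a(1)] near dist_triangle[of a b "X \<omega>"]
      by (simp add: dist_commute flip: dist_norm)
    then have "(3 / 2 * \<delta>) powr r \<le> distortion r \<alpha> (X \<omega>)"
      unfolding a(2) using \<delta> r by (intro powr_mono2) auto
    with upper True show ?thesis by (simp add: g_def)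
  next
    case False
    then show ?thesis using \<alpha> by (auto intro: distortion_antimono)
  qed
  have "(\<integral>\<omega>. distortion r (insert b \<alpha>) (X \<omega>) \<partial>M) + g * measure M B
      = (\<integral>\<omega>. distortion r (insert b \<alpha>) (X \<omega>) + g * indicator B \<omega> \<partial>M)"
    using \<alpha> B distortion_integrable[of "insert b \<alpha>"]
    by (subst Bochner_Integration.integral_add) (auto simp: emeasure_eq_measure)
  also have "\<dots> \<le> (\<integral>\<omega>. distortion r \<alpha> (X \<omega>) \<partial>M)"
    using \<alpha> B distortion_integrable[of "insert b \<alpha>"] distortion_integrable[of \<alpha>] point
    by (intro integral_mono) (auto simp: emeasure_eq_measure)
  finally show ?thesis by (simp add: mB g_def)
qed

text \<open>
  The support points in \<open>S\<close> have mutual distance at least \<open>4 * \<delta>\<close>, so a code point is within \<open>2 * \<delta>\<close> of at most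
  one of them. With more points in \<open>S\<close> than in the codebook, one is left over. The least gain
  \<open>c\<close> over the finitely many candidates in \<open>S\<close> separates the two infima.
\<close>

lemma quant_error_strict_decrease:
  assumes k: "1 \<le> k"
    and supp: "S \<subseteq> measure_supp (distr M borel X)" "finite S" "card S = Suc k"
  shows "quant_error M (Suc k) r X < quant_error M k r X"
proof -
  obtain \<eta> where \<eta>: "0 < \<eta>" "\<And>x y. x \<in> S \<Longrightarrow> y \<in> S \<Longrightarrow> x \<noteq> y \<Longrightarrow> \<eta> \<le> dist x y"
  proof -
    \<comment> \<open>Inserting \<open>1\<close> into this set below gives it a minimum without first exhibiting two distinct points.\<close>
    define T where "T = (\<lambda>(x, y). dist x y) ` (S \<times> S) - {0}"
    show ?thesis
    proof (rule that)
      show "0 < Min (insert 1 T)"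
        using supp(2) by (subst Min_gr_iff) (auto simp: T_def)
      show "Min (insert 1 T) \<le> dist x y" if "x \<in> S" "y \<in> S" "x \<noteq> y" for x y
        using supp(2) that by (intro Min_le) (auto simp: T_def)
    qed
  qed
  define \<delta> where "\<delta> = \<eta> / 4"
  have \<delta>: "0 < \<delta>" using \<eta>(1) by (simp add: \<delta>_def)
  define g where "g b = ((3 / 2 * \<delta>) powr r - (\<delta> / 2) powr r) * measure (distr M borel X) (ball b (\<delta> / 2))" for b
  define c where "c = Min (g ` S)"
  have "S \<noteq> {}" using supp(3) by auto
  have "0 < g b" if "b \<in> S" for b
  proof -
    have "0 < measure (distr M borel X) (ball b (\<delta> / 2))"
      using that supp(1) \<delta> by (auto simp: measure_supp_def)
    then show ?thesis
      using \<delta> r by (auto simp: g_def intro!: mult_pos_pos powr_less_mono2)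
  qed
  then have c: "0 < c" "\<And>b. b \<in> S \<Longrightarrow> c \<le> g b"
    using supp(2) \<open>S \<noteq> {}\<close> by (auto simp: c_def)
  define e where "e n = quant_error M n r X" for n
  have gain: "e (Suc k) powr r + c \<le> (\<integral>\<omega>. distortion r \<alpha> (X \<omega>) \<partial>M)" if "\<alpha> \<in> codebooks k" for \<alpha>
  proof -
    note \<alpha> = codebooks_finite[OF that] codebooks_nonempty[OF that]
    have "\<exists>b\<in>S. \<forall>a\<in>\<alpha>. 2 * \<delta> \<le> dist a b"
    proof (rule ccontr)
      assume "\<not> ?thesis"
      then obtain h where h: "\<And>b. b \<in> S \<Longrightarrow> h b \<in> \<alpha> \<and> dist (h b) b < 2 * \<delta>"
        by (auto simp: not_le) metis
      have "inj_on h S"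
      proof (rule inj_onI, rule ccontr)
        fix x y
        assume xy: "x \<in> S" "y \<in> S" "h x = h y" "x \<noteq> y"
        have "dist x y < 4 * \<delta>"
          using h[OF xy(1)] h[OF xy(2)] xy(3) dist_triangle[of x y "h x"] by (simp add: dist_commute)
        then show False using \<eta>(2)[OF xy(1,2,4)] by (simp add: \<delta>_def)
      qed
      then have "card S \<le> card \<alpha>"
        using h \<alpha> by (intro card_inj_on_le) auto
      then show False using that supp(3) by (simp add: codebooks_def)
    qed
    then obtain b where b: "b \<in> S" "\<And>a. a \<in> \<alpha> \<Longrightarrow> 2 * \<delta> \<le> dist a b" by blast
    define I where "I = (\<integral>\<omega>. distortion r (insert b \<alpha>) (X \<omega>) \<partial>M)"
    have "0 \<le> I" unfolding I_def using \<alpha> by (intro mean_distortion_nonneg) auto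
    have "e (Suc k) \<le> I powr (1 / r)"
      unfolding e_def I_def quant_cost_eq[symmetric]
      by (intro quant_error_le codebooks_insert that)
    then have "e (Suc k) powr r \<le> (I powr (1 / r)) powr r"
      using r quant_error_nonneg[of "Suc k"] by (intro powr_mono2) (auto simp: e_def)
    also have "\<dots> = I" using r \<open>0 \<le> I\<close> by (simp add: powr_powr)
    finally show ?thesis
      using mean_distortion_gain[OF \<alpha> \<delta> b(2)] c(2)[OF b(1)] by (simp add: I_def g_def)
  qed
  have "(e (Suc k) powr r + c) powr (1 / r) \<le> e k"
    unfolding e_def
  proof (rule quant_error_greatest[OF k])
    fix \<alpha> :: "'g set"
    assume "\<alpha> \<in> codebooks k"
    from gain[OF this] show "(quant_error M (Suc k) r X powr r + c) powr (1 / r) \<le> quant_cost M r X \<alpha>"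
      unfolding quant_cost_eq using r c(1) by (intro powr_mono2) (auto simp: e_def)
  qed
  moreover have "e (Suc k) < (e (Suc k) powr r + c) powr (1 / r)"
  proof -
    have "e (Suc k) = (e (Suc k) powr r) powr (1 / r)"
      using r quant_error_nonneg[of "Suc k"] by (simp add: powr_powr e_def)
    also have "\<dots> < (e (Suc k) powr r + c) powr (1 / r)"
      using r c(1) by (intro powr_less_mono2) auto
    finally show ?thesis .
  qed
  ultimately show ?thesis by (simp add: e_def)
qed

end

section \<open>Equality of the errors\<close>

text \<open>
  Tightness provides compact sets whose complements have arbitrarily small measure. Each of them is totally bounded,
  so their union lies in the closure of a countable set.
\<close>

lemma radon_rv_dense_sequence:
  fixes X :: "'w \<Rightarrow> 'a::metric_space"
  assumes X: "radon_rv M X"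
  obtains x :: "nat \<Rightarrow> 'a" where "AE \<omega> in M. X \<omega> \<in> closure (range x)"
proof -
  define P where "P = distr M borel X"
  have P: "prob_space P" "sets P = sets borel"
    and radon: "\<forall>B\<in>sets P. \<forall>\<epsilon>>0. \<exists>K\<subseteq>B. compact K \<and> measure P (B - K) < \<epsilon>"
    using X by (simp_all add: radon_rv_def radon_prob_def P_def)
  have "UNIV \<in> sets P" by (simp add: P(2))
  then have tight: "\<exists>K. compact K \<and> measure P (UNIV - K) < \<epsilon>" if "0 < \<epsilon>" for \<epsilon>
    using radon that by blast
  interpret P: prob_space P by (rule P(1))
  have "\<exists>K. compact K \<and> measure P (UNIV - K) < inverse (real (Suc j))" for j
    by (rule tight) simp
  then obtain K where K: "\<And>j. compact (K j)" "\<And>j. measure P (UNIV - K j) < inverse (real (Suc j))"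
    by metis
  have "\<exists>F. finite F \<and> K j \<subseteq> (\<Union>x\<in>F. ball x (inverse (real (Suc l))))" for j l
    using K(1)[of j] unfolding compact_eq_totally_bounded by simp
  then obtain F where F: "\<And>j l. finite (F j l)"
    "\<And>j l. K j \<subseteq> (\<Union>x\<in>F j l. ball x (inverse (real (Suc l))))"
    by metis
  define D where "D = insert undefined (\<Union>j. \<Union>l. F j l)"
  have "countable (\<Union>j. \<Union>l. F j l)"
    by (rule countable_UN, simp, rule countable_UN, simp, rule countable_finite, rule F(1))
  then have D: "countable D" "D \<noteq> {}" by (auto simp: D_def)
  have dense: "K j \<subseteq> closure D" for j
  proof
    fix y
    assume "y \<in> K j"
    have "\<exists>z\<in>D. dist z y < e" if e: "0 < e" for e
    proof -
      obtain l where l: "inverse (real (Suc l)) < e" using reals_Archimedean[OF e] by blast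
      obtain z where "z \<in> F j l" "dist z y < inverse (real (Suc l))"
        using F(2)[of j l] \<open>y \<in> K j\<close> by auto
      with l show ?thesis by (force simp: D_def)
    qed
    then show "y \<in> closure D" by (simp add: closure_approachable)
  qed
  have K_borel: "K j \<in> sets borel" for j
    using K(1) by (intro borel_closed compact_imp_closed)
  define N where "N = UNIV - (\<Union>j. K j)"
  have N: "N \<in> sets P"
    unfolding N_def P(2) using K_borel by (intro sets.Diff sets.countable_UN) auto
  have "measure P N \<le> 0"
  proof (rule field_le_epsilon)
    fix e :: real
    assume "0 < e"
    then obtain l where l: "inverse (real (Suc l)) < e" using reals_Archimedean by blast
    have "measure P N \<le> measure P (UNIV - K l)"
      using K_borel[of l] by (intro P.finite_measure_mono) (auto simp: N_def P(2) Compl_eq_Diff_UNIV[symmetric])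
    with K(2)[of l] l show "measure P N \<le> 0 + e" by simp
  qed
  then have "N \<in> null_sets P"
    using N measure_nonneg[of P N] by (auto simp: null_sets_def P.emeasure_eq_measure)
  then have "AE x in P. x \<notin> N" by (rule AE_not_in)
  then have "AE \<omega> in M. X \<omega> \<notin> N"
    using X unfolding P_def radon_rv_def by (auto intro: AE_distrD)
  then have "AE \<omega> in M. X \<omega> \<in> closure (range (from_nat_into D))"
    by eventually_elim (use dense in \<open>auto simp: N_def range_from_nat_into[OF D(2,1)]\<close>)
  then show ?thesis by (rule that)
qed

context quantized_rv
begin

lemma embedded: "quantized_rv M r (canonical_embedding \<circ> X)"
proof unfold_locales
  show "canonical_embedding \<circ> X \<in> borel_measurable M"
    using X by (rule measurable_comp)
      (intro borel_measurable_continuous_onI continuous_on_canonical_embedding)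
qed (use r moment in auto)

lemma quant_cost_embedding:
  "quant_cost M r (canonical_embedding \<circ> X) (canonical_embedding ` \<alpha>) = quant_cost M r X \<alpha>"
  unfolding quant_cost_eq quantized_rv.quant_cost_eq[OF embedded]
  by (simp add: distortion_isometry)

lemma quant_error_embedding_le:
  assumes "1 \<le> n"
  shows "quant_error M n r (canonical_embedding \<circ> X) \<le> quant_error M n r X"
proof (rule quant_error_greatest[OF assms])
  interpret J: quantized_rv M r "canonical_embedding \<circ> X" by (rule embedded)
  fix \<alpha> :: "'g set"
  assume "\<alpha> \<in> codebooks n"
  from J.quant_error_le[OF codebooks_image[OF this, of canonical_embedding]]
  show "quant_error M n r (canonical_embedding \<circ> X) \<le> quant_cost M r X \<alpha>"
    by (simp only: quant_cost_embedding)
qed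

text \<open>
  Each point \<open>a\<close> of a codebook of the bidual is replaced by points \<open>b a k\<close> of the original space that imitate its distances
  to \<open>x 0, \<dots>, x k\<close> up to \<open>1 / Suc k\<close>. The new distortions need not converge, but their limit superior
  is at most the old distortion; taking the maximum with the latter gives functions \<open>h k\<close> that do
  converge. The distance to \<open>x 0\<close> is always controlled, so the points \<open>b a k\<close> stay bounded in \<open>k\<close>, which
  provides the integrable majorant.
\<close>

lemma quant_error_le_embedding:
  fixes x :: "nat \<Rightarrow> 'g"
  assumes n: "1 \<le> n" and dense: "AE \<omega> in M. X \<omega> \<in> closure (range x)"
  shows "quant_error M n r X \<le> quant_error M n r (canonical_embedding \<circ> X)"
proof -
  interpret J: quantized_rv M r "canonical_embedding \<circ> X" by (rule embedded)
  show ?thesis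
  proof (rule J.quant_error_greatest[OF n])
    fix \<alpha> :: "(('g \<Rightarrow>\<^sub>L real) \<Rightarrow>\<^sub>L real) set"
    assume \<alpha>_n: "\<alpha> \<in> codebooks n"
    note \<alpha> = codebooks_finite[OF \<alpha>_n] codebooks_nonempty[OF \<alpha>_n]
    have "\<exists>b. \<forall>a k. \<forall>i\<le>k. norm (x i - b a k)
        \<le> norm (canonical_embedding (x i) - a) + inverse (real (Suc k))"
    proof (intro choice allI)
      fix a :: "('g \<Rightarrow>\<^sub>L real) \<Rightarrow>\<^sub>L real" and k
      show "\<exists>u. \<forall>i\<le>k. norm (x i - u) \<le> norm (canonical_embedding (x i) - a) + inverse (real (Suc k))"
        by (rule bidual_point_approximation_finite[of "inverse (real (Suc k))" "x ` {..k}" a]) auto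
    qed
    then obtain b where b: "\<And>a k i. i \<le> k \<Longrightarrow>
        norm (x i - b a k) \<le> norm (canonical_embedding (x i) - a) + inverse (real (Suc k))"
      by blast
    define \<beta> where "\<beta> k = (\<lambda>a. b a k) ` \<alpha>" for k
    have \<beta>: "\<beta> k \<in> codebooks n" for k
      unfolding \<beta>_def by (rule codebooks_image[OF \<alpha>_n])
    note \<beta>_fin = codebooks_finite[OF \<beta>] codebooks_nonempty[OF \<beta>]
    define d where "d \<omega> = distortion r \<alpha> (canonical_embedding (X \<omega>))" for \<omega>
    define h where "h k \<omega> = max (distortion r (\<beta> k) (X \<omega>)) (d \<omega>)" for k \<omega>
    have d_int: "integrable M d"
      using J.distortion_integrable[OF \<alpha>] by (simp add: d_def[abs_def])
    have h_int: "integrable M (h k)" for k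
      unfolding h_def[abs_def] using distortion_integrable[OF \<beta>_fin] d_int by (rule integrable_max)
    obtain a0 where a0: "a0 \<in> \<alpha>" using \<alpha> by blast
    define R where "R = norm a0 + 2 * norm (x 0) + 1"
    have b_bound: "norm (b a0 k) \<le> R" for k
    proof -
      have "inverse (real (Suc k)) \<le> 1" by (simp add: inverse_le_1_iff)
      moreover have "norm (canonical_embedding (x 0) - a0) \<le> norm (x 0) + norm a0"
        using norm_triangle_ineq4[of "canonical_embedding (x 0)" a0] by simp
      moreover have "norm (b a0 k) \<le> norm (x 0) + norm (x 0 - b a0 k)"
        using norm_triangle_ineq4[of "x 0" "x 0 - b a0 k"] by simp
      ultimately show ?thesis using b[of 0 k a0] by (simp add: R_def)
    qed
    have h_bound: "norm (h k \<omega>) \<le> (norm (X \<omega>) + R) powr r" for k \<omega>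
    proof -
      have "d \<omega> \<le> norm (canonical_embedding (X \<omega>) - a0) powr r"
        unfolding d_def using \<alpha>(1) a0 by (rule distortion_le)
      also have "\<dots> \<le> (norm (X \<omega>) + R) powr r"
        using r norm_triangle_ineq4[of "canonical_embedding (X \<omega>)" a0]
        by (intro powr_mono2) (auto simp: R_def intro: order_trans)
      finally have 1: "d \<omega> \<le> (norm (X \<omega>) + R) powr r" .
      have "distortion r (\<beta> k) (X \<omega>) \<le> norm (X \<omega> - b a0 k) powr r"
        using \<beta>_fin(1) a0 by (intro distortion_le) (auto simp: \<beta>_def)
      also have "\<dots> \<le> (norm (X \<omega>) + R) powr r"
        using r norm_triangle_ineq4[of "X \<omega>" "b a0 k"] b_bound[of k]
        by (intro powr_mono2) auto
      finally have "h k \<omega> \<le> (norm (X \<omega>) + R) powr r" using 1 by (simp add: h_def)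
      moreover have "0 \<le> h k \<omega>"
        using distortion_nonneg[OF \<alpha>] by (simp add: h_def d_def le_max_iff_disj)
      ultimately show ?thesis by simp
    qed
    have h_lim: "(\<lambda>k. h k \<omega>) \<longlonglongrightarrow> d \<omega>" if y: "X \<omega> \<in> closure (range x)" for \<omega>
    proof -
      obtain a where a: "a \<in> \<alpha>" "d \<omega> = norm (canonical_embedding (X \<omega>) - a) powr r"
        unfolding d_def using distortion_attained[OF \<alpha>] by blast
      define t where "t = norm (canonical_embedding (X \<omega>) - a)"
      have "0 \<le> t" by (simp add: t_def)
      have "(\<lambda>k. max (norm (X \<omega> - b a k)) t) \<longlonglongrightarrow> t"
      proof (rule order_tendstoI)
        fix u
        assume "u < t"
        then show "\<forall>\<^sub>F k in sequentially. u < max (norm (X \<omega> - b a k)) t"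
          by (simp add: less_max_iff_disj)
      next
        fix u
        assume "t < u"
        then show "\<forall>\<^sub>F k in sequentially. max (norm (X \<omega> - b a k)) t < u"
          using bidual_approximation_limsup[of x "b a" a "X \<omega>" "u - t", OF b y] by (simp add: t_def)
      qed
      then have lim: "(\<lambda>k. max (norm (X \<omega> - b a k)) t powr r) \<longlonglongrightarrow> d \<omega>"
        unfolding a(2) t_def[symmetric] using r \<open>0 \<le> t\<close>
        by (intro tendsto_powr' tendsto_const) (auto simp: le_max_iff_disj)
      show ?thesis
      proof (rule tendsto_sandwich[OF _ _ tendsto_const lim])
        show "\<forall>\<^sub>F k in sequentially. d \<omega> \<le> h k \<omega>" by (simp add: h_def)
        have "distortion r (\<beta> k) (X \<omega>) \<le> norm (X \<omega> - b a k) powr r" for k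
          using \<beta>_fin(1) a(1) by (intro distortion_le) (auto simp: \<beta>_def)
        moreover have "norm (X \<omega> - b a k) powr r \<le> max (norm (X \<omega> - b a k)) t powr r" for k
          using r by (intro powr_mono2) auto
        moreover have "d \<omega> \<le> max (norm (X \<omega> - b a k)) t powr r" for k
          unfolding a(2) t_def[symmetric] using r \<open>0 \<le> t\<close> by (intro powr_mono2) auto
        ultimately show "\<forall>\<^sub>F k in sequentially. h k \<omega> \<le> max (norm (X \<omega> - b a k)) t powr r"
          unfolding h_def by (intro always_eventually allI max.boundedI) (auto intro: order_trans)
      qed
    qed
    have "(\<lambda>k. \<integral>\<omega>. h k \<omega> \<partial>M) \<longlonglongrightarrow> (\<integral>\<omega>. d \<omega> \<partial>M)"
    proof (rule integral_dominated_convergence)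
      show "integrable M (\<lambda>\<omega>. (norm (X \<omega>) + R) powr r)"
        by (rule integrable_norm_plus) (simp add: R_def)
      show "AE \<omega> in M. (\<lambda>k. h k \<omega>) \<longlonglongrightarrow> d \<omega>"
        using dense by eventually_elim (rule h_lim)
    qed (use d_int h_int h_bound in auto)
    then have "(\<lambda>k. (\<integral>\<omega>. h k \<omega> \<partial>M) powr (1 / r)) \<longlonglongrightarrow> (\<integral>\<omega>. d \<omega> \<partial>M) powr (1 / r)"
    proof (intro tendsto_powr' tendsto_const)
      have "0 \<le> h k \<omega>" for k \<omega>
        using distortion_nonneg[OF \<alpha>] by (simp add: h_def d_def le_max_iff_disj)
      then show "(\<integral>\<omega>. d \<omega> \<partial>M) \<noteq> 0 \<or> 0 < 1 / r \<and> (\<forall>\<^sub>F k in sequentially. 0 \<le> (\<integral>\<omega>. h k \<omega> \<partial>M))"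
        using r by (intro disjI2 conjI always_eventually allI integral_nonneg_AE AE_I2) auto
    qed
    also have "(\<integral>\<omega>. d \<omega> \<partial>M) powr (1 / r) = quant_cost M r (canonical_embedding \<circ> X) \<alpha>"
      by (simp add: J.quant_cost_eq d_def)
    finally show "quant_error M n r X \<le> quant_cost M r (canonical_embedding \<circ> X) \<alpha>"
    proof (rule LIMSEQ_le_const, intro exI allI impI)
      fix k
      have "quant_error M n r X \<le> quant_cost M r X (\<beta> k)" by (rule quant_error_le[OF \<beta>])
      also have "\<dots> \<le> (\<integral>\<omega>. h k \<omega> \<partial>M) powr (1 / r)"
        unfolding quant_cost_eq
      proof (rule powr_mono2)
        show "(\<integral>\<omega>. distortion r (\<beta> k) (X \<omega>) \<partial>M) \<le> (\<integral>\<omega>. h k \<omega> \<partial>M)"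
          using distortion_integrable[OF \<beta>_fin] h_int by (rule integral_mono) (simp add: h_def)
      qed (use r mean_distortion_nonneg[OF \<beta>_fin] in auto)
      finally show "quant_error M n r X \<le> (\<integral>\<omega>. h k \<omega> \<partial>M) powr (1 / r)" .
    qed
  qed
qed

end

section \<open>Optimal codebooks over admissible spaces\<close>

context quantized_rv
begin

text \<open>
  Two ordered functions with the same mean agree almost everywhere. The set where they
  differ is open by continuity, and an open null set misses the support.
\<close>

lemma eq_on_support_of_mean_le:
  assumes fg: "continuous_on UNIV f" "continuous_on UNIV g" "\<And>x. f x \<le> g x"
    and int: "integrable M (\<lambda>\<omega>. f (X \<omega>))" "integrable M (\<lambda>\<omega>. g (X \<omega>))"
    and mean: "(\<integral>\<omega>. g (X \<omega>) \<partial>M) \<le> (\<integral>\<omega>. f (X \<omega>) \<partial>M)"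
    and x: "x \<in> measure_supp (distr M borel X)"
  shows "f x = (g x :: real)"
proof (rule ccontr)
  assume "f x \<noteq> g x"
  with fg(3)[of x] have "f x < g x" by simp
  define U where "U = {y. f y < g y}"
  have "open U" unfolding U_def using fg(1,2) by (intro open_Collect_less)
  have "(\<integral>\<omega>. g (X \<omega>) - f (X \<omega>) \<partial>M) = 0"
    using mean integral_mono[OF int] fg(3) int by (simp add: antisym)
  then have "AE \<omega> in M. g (X \<omega>) - f (X \<omega>) = 0"
    using int fg(3) by (subst (asm) integral_nonneg_eq_0_iff_AE) auto
  then have "AE \<omega> in M. X \<omega> \<notin> U"
    by eventually_elim (simp add: U_def)
  then have "prob (X -` U \<inter> space M) = 0"
    using measurable_sets[OF X borel_open[OF \<open>open U\<close>]] by (subst prob_eq_0) auto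
  then have "measure (distr M borel X) U = 0"
    using \<open>open U\<close> by (subst measure_distr[OF X]) auto
  moreover have "0 < measure (distr M borel X) U"
    using x \<open>open U\<close> \<open>f x < g x\<close> by (auto simp: measure_supp_def U_def)
  ultimately show False by simp
qed

lemma optimal_codebooks_embedding:
  assumes err: "quant_error M n r X = quant_error M n r (canonical_embedding \<circ> X)"
  shows "(`) canonical_embedding ` optimal_codebooks M n r X =
    {\<alpha> \<in> optimal_codebooks M n r (canonical_embedding \<circ> X). \<alpha> \<subseteq> range canonical_embedding}"
proof -
  have "canonical_embedding ` \<beta> \<in> optimal_codebooks M n r (canonical_embedding \<circ> X)
      \<longleftrightarrow> \<beta> \<in> optimal_codebooks M n r X" for \<beta>
    by (simp add: optimal_codebooks_def quant_cost_embedding err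
        codebooks_inj_image[OF inj_canonical_embedding])
  then show ?thesis by (auto simp: subset_image_iff)
qed

text \<open>
  The codebook \<open>\<beta>\<close> that replaces every point of \<open>\<alpha>\<close> by a dominating point of the original space is again optimal
  and has the same distortion at every point. Therefore each of its points lies in \<open>\<alpha>\<close>. If some \<open>a1\<close>
  in \<open>\<alpha>\<close> were outside the range, \<open>\<beta>\<close> would be strictly smaller than \<open>\<alpha>\<close> with the same error,
  contradicting the strict decrease. That applies because the point \<open>a1\<close> also
  excludes the trivial space, so the support is infinite.
\<close>

lemma optimal_codebook_subset_range:
  fixes \<alpha> :: "(('g \<Rightarrow>\<^sub>L real) \<Rightarrow>\<^sub>L real) set"
  assumes adm: "admissible_space TYPE('g)"
    and supp: "measure_supp (distr M borel X) = UNIV"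
    and err: "quant_error M n r X = quant_error M n r (canonical_embedding \<circ> X)"
    and opt: "\<alpha> \<in> optimal_codebooks M n r (canonical_embedding \<circ> X)"
  shows "\<alpha> \<subseteq> range canonical_embedding"
proof (rule subsetI, rule ccontr)
  fix a1
  assume a1: "a1 \<in> \<alpha>" "a1 \<notin> range canonical_embedding"
  interpret J: quantized_rv M r "canonical_embedding \<circ> X" by (rule embedded)
  have \<alpha>_n: "\<alpha> \<in> codebooks n" and cost_\<alpha>: "quant_cost M r (canonical_embedding \<circ> X) \<alpha> = quant_error M n r X"
    using opt err by (auto simp: optimal_codebooks_def)
  note \<alpha> = codebooks_finite[OF \<alpha>_n] codebooks_nonempty[OF \<alpha>_n]
  have "\<exists>b. \<forall>x. norm (x - b) \<le> norm (canonical_embedding x - a)" for a :: "('g \<Rightarrow>\<^sub>L real) \<Rightarrow>\<^sub>L real"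
    by (rule admissible_bidual_domination[OF adm, of a]) blast
  then obtain b :: "(('g \<Rightarrow>\<^sub>L real) \<Rightarrow>\<^sub>L real) \<Rightarrow> 'g"
    where b: "\<And>a x. norm (x - b a) \<le> norm (canonical_embedding x - a)"
    by metis
  define \<beta> where "\<beta> = b ` \<alpha>"
  have \<beta>_n: "\<beta> \<in> codebooks n" unfolding \<beta>_def by (rule codebooks_image[OF \<alpha>_n])
  note \<beta> = codebooks_finite[OF \<beta>_n] codebooks_nonempty[OF \<beta>_n]
  have le: "distortion r \<beta> x \<le> distortion r \<alpha> (canonical_embedding x)" for x
  proof -
    obtain a where a: "a \<in> \<alpha>" "distortion r \<alpha> (canonical_embedding x) = norm (canonical_embedding x - a) powr r"
      using distortion_attained[OF \<alpha>] by blast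
    have "distortion r \<beta> x \<le> norm (x - b a) powr r"
      using \<beta>(1) a(1) by (intro distortion_le) (auto simp: \<beta>_def)
    also have "\<dots> \<le> norm (canonical_embedding x - a) powr r"
      using b r by (intro powr_mono2) auto
    finally show ?thesis by (simp add: a(2))
  qed
  have int: "integrable M (\<lambda>\<omega>. distortion r \<beta> (X \<omega>))"
    "integrable M (\<lambda>\<omega>. distortion r \<alpha> (canonical_embedding (X \<omega>)))"
    using distortion_integrable[OF \<beta>] J.distortion_integrable[OF \<alpha>] by simp_all
  have mean_le: "(\<integral>\<omega>. distortion r \<beta> (X \<omega>) \<partial>M) \<le> (\<integral>\<omega>. distortion r \<alpha> (canonical_embedding (X \<omega>)) \<partial>M)"
    using int le by (intro integral_mono)
  have mean_ge: "(\<integral>\<omega>. distortion r \<alpha> (canonical_embedding (X \<omega>)) \<partial>M) \<le> (\<integral>\<omega>. distortion r \<beta> (X \<omega>) \<partial>M)"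
  proof (rule ccontr)
    assume "\<not> ?thesis"
    then have "quant_cost M r X \<beta> < quant_cost M r (canonical_embedding \<circ> X) \<alpha>"
      unfolding quant_cost_eq J.quant_cost_eq
      using r mean_distortion_nonneg[OF \<beta>] by (intro powr_less_mono2) auto
    then show False using quant_error_le[OF \<beta>_n] cost_\<alpha> by simp
  qed
  have cost_\<beta>: "quant_cost M r X \<beta> = quant_error M n r X"
    using mean_le mean_ge by (simp add: quant_cost_eq J.quant_cost_eq flip: cost_\<alpha>)
  have eq: "distortion r \<beta> x = distortion r \<alpha> (canonical_embedding x)" for x
  proof (rule eq_on_support_of_mean_le[OF _ _ le int mean_ge])
    show "continuous_on UNIV (distortion r \<beta>)" by (rule continuous_on_distortion[OF r \<beta>])
    show "continuous_on UNIV (\<lambda>x. distortion r \<alpha> (canonical_embedding x))"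
      by (rule continuous_on_compose2[OF continuous_on_distortion[OF r \<alpha>] continuous_on_canonical_embedding]) simp
  qed (simp add: supp)
  have "canonical_embedding (b a) \<in> \<alpha>" if a: "a \<in> \<alpha>" for a
  proof -
    have "distortion r \<beta> (b a) \<le> norm (b a - b a) powr r"
      using \<beta>(1) a by (intro distortion_le) (auto simp: \<beta>_def)
    then have "distortion r \<alpha> (canonical_embedding (b a)) = 0"
      using distortion_nonneg[OF \<beta>, of r "b a"] by (simp add: eq)
    moreover obtain a' where "a' \<in> \<alpha>"
      "distortion r \<alpha> (canonical_embedding (b a)) = norm (canonical_embedding (b a) - a') powr r"
      using distortion_attained[OF \<alpha>] by blast
    ultimately show ?thesis by simp
  qed
  then have "canonical_embedding ` \<beta> \<subseteq> \<alpha>" by (auto simp: \<beta>_def)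
  moreover have "a1 \<notin> canonical_embedding ` \<beta>" using a1(2) by blast
  ultimately have "canonical_embedding ` \<beta> \<subset> \<alpha>" using a1(1) by blast
  then have "card (canonical_embedding ` \<beta>) < card \<alpha>"
    by (rule psubset_card_mono[OF \<alpha>(1)])
  then have card: "card \<beta> < n"
    using codebooks_card[OF \<alpha>_n] by (simp add: card_image inj_on_subset[OF inj_canonical_embedding])
  have card_pos: "1 \<le> card \<beta>" using \<beta> by (simp add: Suc_le_eq card_gt_0_iff)
  have "\<exists>u :: 'g. u \<noteq> 0"
  proof (rule ccontr)
    assume trivial: "\<nexists>u :: 'g. u \<noteq> 0"
    then have all_0: "x = 0" for x :: 'g by blast
    have "f = 0" for f :: "'g \<Rightarrow>\<^sub>L real"
    proof (rule blinfun_eqI)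
      show "blinfun_apply f x = blinfun_apply 0 x" for x
        by (subst (1 2) all_0[of x]) simp
    qed
    note dual_0 = this
    have "a1 = canonical_embedding 0"
    proof (rule blinfun_eqI)
      show "blinfun_apply a1 f = blinfun_apply (canonical_embedding 0) f" for f
        by (subst (1 2) dual_0[of f]) simp
    qed
    with a1(2) show False by blast
  qed
  then obtain u :: 'g where u: "u \<noteq> 0" by blast
  have "inj (\<lambda>k :: nat. real k *\<^sub>R u)" using u by (intro injI) simp
  then have "infinite (UNIV :: 'g set)"
    using infinite_super[OF subset_UNIV range_inj_infinite] by blast
  then obtain S :: "'g set" where S: "finite S" "card S = Suc (card \<beta>)"
    using infinite_arbitrarily_large by blast
  have "quant_error M (card \<beta>) r X \<le> quant_error M n r X"
    using quant_error_le[of \<beta> "card \<beta>"] \<beta> cost_\<beta> by (simp add: codebooksI)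
  also have "\<dots> \<le> quant_error M (Suc (card \<beta>)) r X"
    using card by (intro quant_error_antimono) auto
  also have "\<dots> < quant_error M (card \<beta>) r X"
    using S by (intro quant_error_strict_decrease[OF card_pos, of S]) (auto simp: supp)
  finally show False by simp
qed

end

theorem theorem2:
  fixes M :: "'w measure" and X :: "'w \<Rightarrow> 'a::banach" and r :: real
  assumes "prob_space M"
    and "0 < r"
    and "radon_rv M X"
    and "integrable M (\<lambda>\<omega>. norm (X \<omega>) powr r)"
  shows
    "(\<forall>n\<ge>1.
        quant_error M n r X = quant_error M n r (canonical_embedding \<circ> X) \<and>
        (`) canonical_embedding ` optimal_codebooks M n r X =
          {\<alpha> \<in> optimal_codebooks M n r (canonical_embedding \<circ> X). \<alpha> \<subseteq> range canonical_embedding} \<and>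
        (infinite (measure_supp (distr M borel X)) \<or> n \<le> card (measure_supp (distr M borel X)) \<longrightarrow>
          (\<forall>k. 1 \<le> k \<and> k < n \<longrightarrow> quant_error M k r X > quant_error M (Suc k) r X))) \<and>
     (admissible_space TYPE('a) \<and> measure_supp (distr M borel X) = UNIV \<longrightarrow>
        (\<forall>n\<ge>1. (`) canonical_embedding ` optimal_codebooks M n r X =
          optimal_codebooks M n r (canonical_embedding \<circ> X)))"
proof -
  interpret quantized_rv M r X
    using assms by (simp add: quantized_rv_def quantized_rv_axioms_def radon_rv_def)
  obtain x :: "nat \<Rightarrow> 'a" where x: "AE \<omega> in M. X \<omega> \<in> closure (range x)"
    using radon_rv_dense_sequence[OF assms(3)] .
  have err: "quant_error M n r X = quant_error M n r (canonical_embedding \<circ> X)" if "1 \<le> n" for n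
    using quant_error_le_embedding[OF that x] quant_error_embedding_le[OF that] by (rule antisym)
  note opt = optimal_codebooks_embedding[OF err]
  have decrease: "quant_error M (Suc k) r X < quant_error M k r X"
    if supp: "infinite (measure_supp (distr M borel X)) \<or> n \<le> card (measure_supp (distr M borel X))"
      and k: "1 \<le> k" "k < n" for n k
  proof -
    have "\<exists>S \<subseteq> measure_supp (distr M borel X). finite S \<and> card S = Suc k"
    proof (cases "finite (measure_supp (distr M borel X))")
      case True
      with supp k have "Suc k \<le> card (measure_supp (distr M borel X))" by simp
      then show ?thesis by (rule obtain_subset_with_card_n) blast
    next
      case False
      then show ?thesis
        using infinite_arbitrarily_large[of "measure_supp (distr M borel X)" "Suc k"] by blast
    qed
    then show ?thesis using quant_error_strict_decrease[OF k(1)] by blast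
  qed
  have admissible: "(`) canonical_embedding ` optimal_codebooks M n r X =
      optimal_codebooks M n r (canonical_embedding \<circ> X)"
    if "admissible_space TYPE('a)" "measure_supp (distr M borel X) = UNIV" "1 \<le> n" for n
  proof -
    note in_range = optimal_codebook_subset_range[OF that(1,2) err[OF that(3)]]
    show ?thesis unfolding opt[OF that(3)] by (rule equalityI, blast, rule subsetI, simp add: in_range)
  qed
  show ?thesis
  proof (intro conjI allI impI)
    fix n :: nat
    assume n: "1 \<le> n"
    show "quant_error M n r X = quant_error M n r (canonical_embedding \<circ> X)"
      by (rule err[OF n])
    show "(`) canonical_embedding ` optimal_codebooks M n r X =
        {\<alpha> \<in> optimal_codebooks M n r (canonical_embedding \<circ> X). \<alpha> \<subseteq> range canonical_embedding}"
      by (rule opt[OF n])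
    fix k
    assume "infinite (measure_supp (distr M borel X)) \<or> n \<le> card (measure_supp (distr M borel X))"
      and "1 \<le> k \<and> k < n"
    then show "quant_error M k r X > quant_error M (Suc k) r X"
      using decrease by blast
  next
    fix n :: nat
    assume "admissible_space TYPE('a) \<and> measure_supp (distr M borel X) = UNIV" and "1 \<le> n"
    then show "(`) canonical_embedding ` optimal_codebooks M n r X =
        optimal_codebooks M n r (canonical_embedding \<circ> X)"
      using admissible by blast
  qed
qed

end
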